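(* Let $C=\{z\in\mathbb{C}:|z|=1\}$ be the unit circle and $\mathcal{D}^+=\{z\in\mathbb{C}:|z|<1\}$. Let $f$ be a function that is regular (analytic) in $\mathcal{D}^+$ and on $C$, and whose values on $C$ are prescribed by the Fourier series $$f(e^{i\theta})=\sum_{n\ge 0}c_n e^{in\theta}\qquad(-\pi\le\theta\le\pi),$$ with exactly known coefficients $c_n=\frac{1}{2\pi}\int_{-\pi}^{\pi}e^{-in\theta}f(e^{i\theta})\,d\theta$. Suppose that $f$ has a single singularity, of unknown magnitude, unknown location $z_1$ with $|z_1|\ge 1$, and unknown key index $k\in\mathbb{R}$; that is, either (a) (algebraic type) $f(z)=M(z_1-z)^k$ with $M\in\mathbb{C}\setminus\{0\}$ and $k\in\mathbb{R}$, or (b) (logarithmic type, for which the key index is $k=0$) $f(z)=M_\ell\log(z_1-z)$ with $M_\ell\in\mathbb{C}\setminus\{0\}$. For every integer $n\ge 1$ with $c_n\neq 0$ and $c_{n+1}\ne 0$, put $$R_n=\frac{c_{n+1}}{c_n},\qquad D_n=\frac{R_{n+1}}{R_n},\quad\text{where } R_{n+1}=\frac{c_{n+2}}{c_{n+1}}.$$ Then for every such $n$, $$k=n+\frac{n+1}{\,n+1-(n+2)D_n\,},\qquad z_1=\frac{n-k}{(n+1)R_n},$$ and the magnitude is given by $$M=\frac{c_0}{z_1^{k}}\ \text{ in case (a)},\qquad M_\ell=\frac{c_0}{\log z_1}\ \text{ in case (b)}.$$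
   Context: A "singularity" here is understood in the generic sense of a point $z_1$ at which $f$ has the form $M(z_1-z)^k$ with $k$ real (a zero if $k$ is a positive integer, a pole if $k$ is a negative integer, an algebraic branch point joined to $\infty$ by a branch cut if $k$ is not an integer) or $M_\ell\log(z_1-z)$ (a logarithmic branch point, assigned key index $k=0$). Branch cuts lie outside the unit circle. The multivalued functions $(z_1-z)^k$ and $\log(z_1-z)$ denote a fixed single-valued branch analytic in $\mathcal{D}^+$ and on $C$, and $z_1^k$, $\log z_1$ denote the values of that same branch at $z=0$. *)

theory Defs
  imports "HOL-Complex_Analysis.Complex_Analysis"
begin

(* A branch of the multivalued function z |-> (z1 - z)^k, analytic in the unit disc and on the
   unit circle: an analytic selection from the values exp (k * w), where w runs through the
   logarithms of z1 - z.  No value is prescribed at z = z1, where there are no such logarithms.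
   For |z1| >= 1 this matters only if |z1| = 1 and k is a nonnegative integer, and there the value
   is forced by continuity; for any other k, a branch exists only if |z1| > 1. *)
definition power_branch :: "complex \<Rightarrow> real \<Rightarrow> (complex \<Rightarrow> complex) \<Rightarrow> bool" where
  "power_branch z1 k b \<longleftrightarrow>
     b analytic_on cball 0 1 \<and>
     (\<forall>z \<in> cball 0 1 - {z1}. \<exists>w. exp w = z1 - z \<and> b z = exp (of_real k * w))"

(* Existence of such a branch forces |z1| > 1, and hence b 0 \<noteq> 0. *)
definition log_branch :: "complex \<Rightarrow> (complex \<Rightarrow> complex) \<Rightarrow> bool" where
  "log_branch z1 b \<longleftrightarrow>
     b analytic_on cball 0 1 \<and> (\<forall>z \<in> cball 0 1. exp (b z) = z1 - z)"

(* In the next two definitions b is the fixed branch of (z1 - z)^k or log (z1 - z), so that b 0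
   is the value denoted by z1^k or log z1. *)
definition algebraic_type ::
    "(complex \<Rightarrow> complex) \<Rightarrow> complex \<Rightarrow> real \<Rightarrow> complex \<Rightarrow> (complex \<Rightarrow> complex) \<Rightarrow> bool" where
  "algebraic_type f z1 k M b \<longleftrightarrow>
     M \<noteq> 0 \<and> power_branch z1 k b \<and> (\<forall>z \<in> cball 0 1. f z = M * b z)"

definition logarithmic_type ::
    "(complex \<Rightarrow> complex) \<Rightarrow> complex \<Rightarrow> real \<Rightarrow> complex \<Rightarrow> (complex \<Rightarrow> complex) \<Rightarrow> bool" where
  "logarithmic_type f z1 k M b \<longleftrightarrow>
     k = 0 \<and> M \<noteq> 0 \<and> log_branch z1 b \<and> (\<forall>z \<in> cball 0 1. f z = M * b z)"

definition R :: "(nat \<Rightarrow> complex) \<Rightarrow> nat \<Rightarrow> complex" where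
  "R c n = c (n + 1) / c n"

definition D :: "(nat \<Rightarrow> complex) \<Rightarrow> nat \<Rightarrow> complex" where
  "D c n = R c (n + 1) / R c n"

end

theory Submission imports Defs begin

text \<open>
  A function of either type satisfies the first-order differential equation
  \<open>(z1 - z) * f' z = A - k * f z\<close> on the open unit disc, where \<open>A = 0\<close> in the algebraic case
  (for \<open>M * (z1 - z)\<^sup>k\<close>) and \<open>k = 0\<close>, \<open>A = - M\<close> in the logarithmic case.  Differentiating \<open>n\<close>
  times removes the constant \<open>A\<close> as soon as \<open>n \<ge> 1\<close> and leaves, at the origin,
  a two-term recurrence for the Taylor coefficients,
  \<open>z1 * (n + 1) * c (n + 1) = (n - k) * c n\<close>.  This is lemma \<open>taylor_recurrence\<close>, and it
  is the reason why the two types of singularity can share one pair of formulas.  By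
  Cauchy's formula the Fourier coefficients on the circle are these Taylor coefficients
  (lemma \<open>fourier_coefficient_eq_taylor\<close>).

  Read as \<open>R n = (n - k) / ((n + 1) * z1)\<close>, the recurrence gives \<open>z1\<close> when \<open>k\<close> is known.  In the
  quotient of two consecutive ratios \<open>z1\<close> cancels, so \<open>D n\<close> depends on \<open>n\<close> and \<open>k\<close> alone, through
  a Moebius transformation of \<open>k\<close> that is solved explicitly.  The magnitude is read off from
  \<open>c 0 = f 0 = M * b 0\<close>, where it has to be seen that \<open>b 0 \<noteq> 0\<close>.

  The branches \<open>b\<close> are only given pointwise as selections from the values of a
  multivalued function.  For the logarithm the identity \<open>exp (b z) = z1 - z\<close> can be
  differentiated at once.  For the power, \<open>b\<close> is compared with \<open>exp (k * L z)\<close> for a holomorphic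
  logarithm \<open>L\<close> of \<open>z1 - z\<close>: because \<open>k\<close> is real, the quotient has modulus one, hence
  is constant by the maximum modulus principle (lemma \<open>power_branch_ode\<close>).
\<close>

section \<open>Fourier coefficients as Taylor coefficients\<close>

lemma has_contour_integral_cong_path:
  assumes "(f has_contour_integral i) p" and eq: "\<And>x. x \<in> {0..1} \<Longrightarrow> p x = q x"
  shows "(f has_contour_integral i) q"
proof -
  have "vector_derivative p (at x within {0..1}) = vector_derivative q (at x within {0..1})"
    if "x \<in> {0..1}" for x
    using that eq by (intro vector_derivative_cong_eq) auto
  then show ?thesis
    using assms(1) eq unfolding has_contour_integral_def by (auto intro: has_integral_eq[rotated])
qed

text \<open>
  Cauchy's formula is stated for \<open>circlepath z r\<close>, which starts at \<open>z + r\<close>, whereas the angle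
  range of the Fourier coefficients, from \<open>-pi\<close> to \<open>pi\<close>, starts at the opposite point.
  Shifting the starting point of a closed path leaves contour integrals unchanged.
\<close>

lemma part_circlepath_eq_shiftpath_circlepath:
  assumes "x \<in> {0..1}"
  shows "part_circlepath z r (-pi) pi x = shiftpath (1/2) (circlepath z r) x"
proof -
  have "shiftpath (1/2) (circlepath z r) x = circlepath z (-r) x"
    using circlepath_minus[of z r x] circlepath_add_half[of z r x]
    by (auto simp: shiftpath_def add.commute)
  also have "\<dots> = part_circlepath z r (-pi) pi x"
  proof -
    have "\<i> * of_real (linepath (-pi) pi x) = 2 * of_real pi * \<i> * of_real x - of_real pi * \<i>"
      by (simp add: linepath_def algebra_simps)
    then show ?thesis
      by (simp add: circlepath part_circlepath_def exp_diff)
  qed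
  finally show ?thesis ..
qed

lemma fourier_coefficient_eq_taylor:
  assumes "continuous_on (cball 0 1) f" "f holomorphic_on ball 0 1"
  shows "1 / (2 * of_real pi) *
           integral {-pi..pi} (\<lambda>\<theta>::real. exp (- \<i> * of_nat n * of_real \<theta>) * f (exp (\<i> * of_real \<theta>)))
         = (deriv ^^ n) f 0 / fact n"
proof -
  let ?g = "\<lambda>u. f u / (u - 0) ^ Suc n"
  let ?I = "2 * of_real pi * \<i> / fact n * (deriv ^^ n) f 0"
  have "(?g has_contour_integral ?I) (circlepath 0 1)"
    using Cauchy_has_contour_integral_higher_derivative_circlepath[of 0 1 f 0 n] assms by simp
  then have "(?g has_contour_integral ?I) (shiftpath (1/2) (circlepath 0 1))"
    by (rule has_contour_integral_shiftpath) auto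
  then have "(?g has_contour_integral ?I) (part_circlepath 0 1 (-pi) pi)"
    by (rule has_contour_integral_cong_path) (auto simp: part_circlepath_eq_shiftpath_circlepath)
  then have "((\<lambda>t. ?g (0 + of_real 1 * cis t) * of_real 1 * \<i> * cis t) has_integral ?I) {-pi..pi}"
    by (subst (asm) has_contour_integral_part_circlepath_iff) auto
  moreover have "?g (0 + of_real 1 * cis t) * of_real 1 * \<i> * cis t =
      \<i> * (exp (- \<i> * of_nat n * of_real t) * f (exp (\<i> * of_real t)))" for t
  proof -
    have "exp (- \<i> * of_nat n * of_real t) = inverse (cis t ^ n)"
      by (simp add: cis_conv_exp exp_minus mult_ac flip: exp_of_nat_mult)
    then show ?thesis
      by (simp add: cis_conv_exp field_simps)
  qed
  ultimately have "((\<lambda>t. \<i> * (exp (- \<i> * of_nat n * of_real t) * f (exp (\<i> * of_real t))))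
      has_integral ?I) {-pi..pi}"
    by simp
  then have "((\<lambda>t. exp (- \<i> * of_nat n * of_real t) * f (exp (\<i> * of_real t)))
      has_integral (?I / \<i>)) {-pi..pi}"
    by (subst (asm) has_integral_mult_right_iff) auto
  then show ?thesis
    by (simp add: integral_unique)
qed

section \<open>The differential equation of a branch\<close>

lemma holomorphic_constant_norm_imp_constant:
  assumes "f holomorphic_on S" "open S" "connected S" "\<And>z. z \<in> S \<Longrightarrow> norm (f z) = r"
  shows "f constant_on S"
proof (cases "S = {}")
  case True
  then show ?thesis by (simp add: constant_on_def)
next
  case False
  then obtain \<xi> where "\<xi> \<in> S" by blast
  then show ?thesis
    using maximum_modulus_principle[of f S S \<xi>] assms by simp
qed

text \<open>
  Two logarithms of the same number have the same real part, so for real \<open>k\<close> all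
  candidate values of \<open>(z1 - z)\<^sup>k\<close> agree in modulus.  This is what forces an analytic selection
  to be a constant multiple of \<open>exp (k * L z)\<close> for any one holomorphic logarithm \<open>L\<close>.
\<close>

lemma power_branch_ode:
  assumes b: "power_branch z1 k b" and z1: "norm z1 \<ge> 1" and z: "z \<in> ball 0 1"
  shows "(z1 - z) * deriv b z = - of_real k * b z"
proof -
  have nz: "z1 - u \<noteq> 0" if "u \<in> ball 0 1" for u
    using that z1 by auto
  have hol_b: "b holomorphic_on ball 0 1"
    using b by (auto simp: power_branch_def intro!: analytic_imp_holomorphic elim!: analytic_on_subset)
  have "(\<lambda>u. z1 - u) holomorphic_on ball 0 1"
    by (intro holomorphic_intros)
  then obtain L where hol_L: "L holomorphic_on ball 0 1"
    and L: "\<And>u. u \<in> ball 0 1 \<Longrightarrow> z1 - u = exp (L u)"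
    using contractible_imp_holomorphic_log[of "\<lambda>u. z1 - u" "ball 0 1"] nz
      convex_imp_contractible[OF convex_ball] by metis
  define q where "q = (\<lambda>u. b u * exp (- of_real k * L u))"
  have "norm (q u) = 1" if u: "u \<in> ball 0 1" for u
  proof -
    have "u \<in> cball 0 1 - {z1}"
      using u nz[OF u] by auto
    then obtain w where w: "exp w = z1 - u" "b u = exp (of_real k * w)"
      using b unfolding power_branch_def by blast
    have "norm (exp w) = norm (exp (L u))"
      using w L[OF u] by simp
    then have "Re w = Re (L u)"
      by simp
    then show ?thesis
      by (simp add: q_def w norm_mult flip: exp_add)
  qed
  moreover have "q holomorphic_on ball 0 1"
    unfolding q_def by (intro holomorphic_intros hol_b hol_L)
  ultimately have "q constant_on ball 0 1"
    by (intro holomorphic_constant_norm_imp_constant[where r = 1]) auto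
  then obtain C where C: "\<And>u. u \<in> ball 0 1 \<Longrightarrow> q u = C"
    by (auto simp: constant_on_def)
  have b_eq: "b u = C * exp (of_real k * L u)" if "u \<in> ball 0 1" for u
    using C[OF that] by (auto simp: q_def exp_minus field_simps)
  have dL: "(L has_field_derivative deriv L z) (at z)"
    using hol_L z by (auto intro!: holomorphic_derivI)
  have "((\<lambda>u. exp (L u)) has_field_derivative exp (L z) * deriv L z) (at z)"
    using dL by (auto intro!: derivative_eq_intros)
  moreover have "((\<lambda>u. exp (L u)) has_field_derivative - 1) (at z)"
    by (rule has_field_derivative_transform_within_open[of "\<lambda>u. z1 - u" _ _ "ball 0 1"])
       (use z L in \<open>auto intro!: derivative_eq_intros\<close>)
  ultimately have exp_L: "(z1 - z) * deriv L z = - 1"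
    using L[OF z] DERIV_unique by metis
  have "((\<lambda>u. C * exp (of_real k * L u)) has_field_derivative
      C * exp (of_real k * L z) * (of_real k * deriv L z)) (at z)"
    using dL by (auto intro!: derivative_eq_intros)
  then have "(b has_field_derivative C * exp (of_real k * L z) * (of_real k * deriv L z)) (at z)"
    by (rule has_field_derivative_transform_within_open[of _ _ _ "ball 0 1"]) (use z b_eq in auto)
  then have "deriv b z = b z * (of_real k * deriv L z)"
    using b_eq[OF z] by (simp add: DERIV_imp_deriv)
  then have "(z1 - z) * deriv b z = of_real k * b z * ((z1 - z) * deriv L z)"
    by (simp add: mult_ac)
  then show ?thesis
    by (simp add: exp_L)
qed

lemma log_branch_ode:
  assumes b: "log_branch z1 b" and z: "z \<in> ball 0 1"
  shows "(z1 - z) * deriv b z = - 1"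
proof -
  have eq: "exp (b u) = z1 - u" if "u \<in> ball 0 1" for u
    using b that by (auto simp: log_branch_def)
  have "b holomorphic_on ball 0 1"
    using b by (auto simp: log_branch_def intro!: analytic_imp_holomorphic elim!: analytic_on_subset)
  then have "(b has_field_derivative deriv b z) (at z)"
    using z by (auto intro!: holomorphic_derivI)
  then have "((\<lambda>u. exp (b u)) has_field_derivative exp (b z) * deriv b z) (at z)"
    by (auto intro!: derivative_eq_intros)
  moreover have "((\<lambda>u. exp (b u)) has_field_derivative - 1) (at z)"
    by (rule has_field_derivative_transform_within_open[of "\<lambda>u. z1 - u" _ _ "ball 0 1"])
       (use z eq in \<open>auto intro!: derivative_eq_intros\<close>)
  ultimately show ?thesis
    using eq[OF z] DERIV_unique by metis
qed

lemma power_branch_0_nonzero: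
  assumes "power_branch z1 k b" "z1 \<noteq> 0"
  shows "b 0 \<noteq> 0"
  using assms by (force simp: power_branch_def)

text \<open>
  A vanishing logarithm at \<open>0\<close> would mean \<open>z1 = 1\<close>; but then \<open>z1\<close> is a point of the closed
  disc at which \<open>z1 - z\<close> has no logarithm.
\<close>

lemma log_branch_0_nonzero:
  assumes "log_branch z1 b"
  shows "b 0 \<noteq> 0"
proof
  assume "b 0 = 0"
  have eq: "exp (b u) = z1 - u" if "u \<in> cball 0 1" for u
    using assms that by (simp add: log_branch_def)
  have "z1 = 1"
    using eq[of 0] \<open>b 0 = 0\<close> by simp
  then show False
    using eq[of 1] by simp
qed

section \<open>The recurrence for the coefficients\<close>

text \<open>
  Each differentiation of \<open>(z1 - z) * f' z\<close> contributes one extra \<open>- f'\<close>, which raises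
  \<open>- k\<close> to \<open>n - k\<close> after \<open>n\<close> steps; the constant \<open>A\<close> only survives at \<open>n = 0\<close>.
\<close>

lemma higher_deriv_recurrence:
  assumes hol: "f holomorphic_on S" and S: "open S"
    and ode: "\<And>z. z \<in> S \<Longrightarrow> (z1 - z) * deriv f z = A - k * f z"
    and z: "z \<in> S"
  shows "(z1 - z) * (deriv ^^ Suc n) f z =
           (of_nat n - k) * (deriv ^^ n) f z + (if n = 0 then A else 0)"
  using z
proof (induction n arbitrary: z)
  case 0
  then show ?case using ode by simp
next
  case (Suc n)
  let ?F = "\<lambda>m. (deriv ^^ m) f"
  have dF: "(?F m has_field_derivative ?F (Suc m) z) (at z)" for m
    using holomorphic_higher_deriv[OF hol S, of m] S Suc.prems
    by (auto intro!: holomorphic_derivI)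
  have "((\<lambda>u. (z1 - u) * ?F (Suc n) u) has_field_derivative
      (z1 - z) * ?F (Suc (Suc n)) z - ?F (Suc n) z) (at z)"
    by (rule derivative_eq_intros dF refl)+ simp
  moreover have "((\<lambda>u. (z1 - u) * ?F (Suc n) u) has_field_derivative
      (of_nat n - k) * ?F (Suc n) z) (at z)"
  proof (rule has_field_derivative_transform_within_open[OF _ S Suc.prems])
    show "((\<lambda>u. (of_nat n - k) * ?F n u + (if n = 0 then A else 0)) has_field_derivative
        (of_nat n - k) * ?F (Suc n) z) (at z)"
      by (rule derivative_eq_intros dF refl)+ simp
  qed (use Suc.IH in simp)
  ultimately have "(z1 - z) * ?F (Suc (Suc n)) z - ?F (Suc n) z = (of_nat n - k) * ?F (Suc n) z"
    by (rule DERIV_unique)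
  then show ?case
    by (simp add: algebra_simps)
qed

lemma taylor_recurrence:
  assumes "f holomorphic_on S" "open S" "0 \<in> S"
    and "\<And>z. z \<in> S \<Longrightarrow> (z1 - z) * deriv f z = A - k * f z"
    and "n \<ge> 1"
  shows "of_nat (n + 1) * z1 * ((deriv ^^ (n + 1)) f 0 / fact (n + 1)) =
           (of_nat n - k) * ((deriv ^^ n) f 0 / fact n)"
proof -
  have "z1 * (deriv ^^ Suc n) f 0 = (of_nat n - k) * (deriv ^^ n) f 0"
    using higher_deriv_recurrence[of f S z1 A k 0 n] assms by simp
  then have "z1 * (deriv ^^ Suc n) f 0 / fact n = (of_nat n - k) * (deriv ^^ n) f 0 / fact n"
    by simp
  moreover have "of_nat (n + 1) * z1 * ((deriv ^^ (n + 1)) f 0 / fact (n + 1)) =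
      z1 * (deriv ^^ Suc n) f 0 / fact n"
    by (simp add: fact_Suc del: of_nat_Suc funpow.simps)
  ultimately show ?thesis
    by simp
qed

section \<open>Recovering the key index and the location\<close>

text \<open>
  The recurrence at \<open>n\<close> and \<open>n + 1\<close> gives \<open>D n = (n + 1) * (n + 1 - k) / ((n + 2) * (n - k))\<close>,
  whence \<open>n + 1 - (n + 2) * D n = - (n + 1) / (n - k)\<close>.  Here \<open>n - k \<noteq> 0\<close> follows from
  \<open>c (n + 1) \<noteq> 0\<close>.  The coefficient \<open>c (n + 2)\<close> may vanish, which is the case \<open>k = n + 1\<close>.
\<close>

lemma index_and_location_from_recurrence:
  fixes c :: "nat \<Rightarrow> complex"
  assumes rec0: "of_nat (n + 1) * z1 * c (n + 1) = (of_nat n - k) * c n"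
    and rec1: "of_nat (n + 2) * z1 * c (n + 2) = (of_nat (n + 1) - k) * c (n + 1)"
    and nz: "c n \<noteq> 0" "c (n + 1) \<noteq> 0" "z1 \<noteq> 0"
  shows "k = of_nat n + (of_nat n + 1) / (of_nat n + 1 - (of_nat n + 2) * D c n)"
    and "z1 = (of_nat n - k) / ((of_nat n + 1) * R c n)"
proof -
  define x :: complex where "x = of_nat n"
  have x1: "x + 1 \<noteq> 0" and x2: "x + 2 \<noteq> 0"
    using of_nat_neq_0[of n, where ?'a = complex] of_nat_neq_0[of "Suc n", where ?'a = complex]
    by (auto simp: x_def add_ac)
  have r0: "(x + 1) * z1 * c (n + 1) = (x - k) * c n"
    using rec0 by (simp add: x_def add_ac)
  have r1: "(x + 2) * z1 * c (n + 2) = (x + 1 - k) * c (n + 1)"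
    using rec1 by (simp add: x_def add_ac)
  have xk: "x - k \<noteq> 0"
    using r0 x1 nz by auto
  have R0: "R c n = (x - k) / ((x + 1) * z1)"
    unfolding R_def using r0 x1 nz by (subst frac_eq_eq) (auto simp: mult_ac)
  have R1: "R c (n + 1) = (x + 1 - k) / ((x + 2) * z1)"
    unfolding R_def using r1 x2 nz by (subst frac_eq_eq) (auto simp: mult_ac)
  have "(x + 2) * D c n = (x + 1) * (x + 1 - k) / (x - k)"
    unfolding D_def R0 R1 using x1 x2 xk nz(3) by simp
  then have "x + 1 - (x + 2) * D c n = - ((x + 1) / (x - k))"
    using xk by (simp add: field_simps)
  then have "(x + 1) / (x + 1 - (x + 2) * D c n) = - (x - k)"
    using x1 xk by simp
  then show "k = of_nat n + (of_nat n + 1) / (of_nat n + 1 - (of_nat n + 2) * D c n)"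
    by (simp add: x_def)
  show "z1 = (of_nat n - k) / ((of_nat n + 1) * R c n)"
    unfolding R0 x_def[symmetric] using x1 xk nz(3) by simp
qed

theorem theorem1:
  fixes f :: "complex \<Rightarrow> complex" and c :: "nat \<Rightarrow> complex"
    and z1 M :: complex and k :: real and b :: "complex \<Rightarrow> complex"
  assumes regular: "f analytic_on cball 0 1"
    and fourier: "\<And>\<theta>::real. \<theta> \<in> {-pi..pi} \<Longrightarrow>
          (\<lambda>n. c n * exp (\<i> * of_nat n * of_real \<theta>)) sums f (exp (\<i> * of_real \<theta>))"
    and coeffs: "\<And>n. c n = 1 / (2 * of_real pi) *
          integral {-pi..pi} (\<lambda>\<theta>::real. exp (- \<i> * of_nat n * of_real \<theta>) * f (exp (\<i> * of_real \<theta>)))"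
    and location: "norm z1 \<ge> 1"
    and singularity: "algebraic_type f z1 k M b \<or> logarithmic_type f z1 k M b"
  shows "(\<forall>n::nat. n \<ge> 1 \<and> c n \<noteq> 0 \<and> c (n + 1) \<noteq> 0 \<longrightarrow>
            complex_of_real k =
              of_nat n + (of_nat n + 1) / (of_nat n + 1 - (of_nat n + 2) * D c n) \<and>
            z1 = (of_nat n - of_real k) / ((of_nat n + 1) * R c n)) \<and>
         (algebraic_type f z1 k M b \<longrightarrow> M = c 0 / b 0) \<and>
         (logarithmic_type f z1 k M b \<longrightarrow> M = c 0 / b 0)"
proof -
  have hol: "f holomorphic_on ball 0 1"
    using regular by (auto intro!: analytic_imp_holomorphic elim!: analytic_on_subset)
  have cont: "continuous_on (cball 0 1) f"
    using regular by (intro holomorphic_on_imp_continuous_on analytic_imp_holomorphic)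
  have c: "c n = (deriv ^^ n) f 0 / fact n" for n
    unfolding coeffs by (rule fourier_coefficient_eq_taylor[OF cont hol])
  have z1: "z1 \<noteq> 0"
    using location by auto
  have deriv_f: "deriv f z = M * deriv b z"
    if eq: "\<And>u. u \<in> cball 0 1 \<Longrightarrow> f u = M * b u" and an: "b analytic_on cball 0 1"
      and z: "z \<in> ball 0 1" for z
  proof -
    have "b holomorphic_on ball 0 1"
      using an by (auto intro!: analytic_imp_holomorphic elim!: analytic_on_subset)
    then have "((\<lambda>u. M * b u) has_field_derivative M * deriv b z) (at z)"
      using z by (auto intro!: derivative_eq_intros holomorphic_derivI)
    then have "(f has_field_derivative M * deriv b z) (at z)"
      by (rule has_field_derivative_transform_within_open[of _ _ _ "ball 0 1"]) (use z eq in auto)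
    then show ?thesis
      by (rule DERIV_imp_deriv)
  qed
  obtain A where ode: "\<And>z. z \<in> ball 0 1 \<Longrightarrow> (z1 - z) * deriv f z = A - of_real k * f z"
    using singularity
  proof
    assume "algebraic_type f z1 k M b"
    then have b: "power_branch z1 k b" and f: "\<And>z. z \<in> cball 0 1 \<Longrightarrow> f z = M * b z"
      by (auto simp: algebraic_type_def)
    have "(z1 - z) * deriv f z = 0 - of_real k * f z" if "z \<in> ball 0 1" for z
    proof -
      have "deriv f z = M * deriv b z"
        by (rule deriv_f) (use that b f in \<open>auto simp: power_branch_def\<close>)
      then have "(z1 - z) * deriv f z = M * ((z1 - z) * deriv b z)"
        by (simp add: mult_ac)
      also have "\<dots> = 0 - of_real k * f z"
        using power_branch_ode[OF b location that] f[of z] that by simp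
      finally show ?thesis .
    qed
    then show ?thesis by (rule that)
  next
    assume "logarithmic_type f z1 k M b"
    then have b: "log_branch z1 b" and f: "\<And>z. z \<in> cball 0 1 \<Longrightarrow> f z = M * b z" and "k = 0"
      by (auto simp: logarithmic_type_def)
    have "(z1 - z) * deriv f z = - M - of_real k * f z" if "z \<in> ball 0 1" for z
    proof -
      have "deriv f z = M * deriv b z"
        by (rule deriv_f) (use that b f in \<open>auto simp: log_branch_def\<close>)
      then have "(z1 - z) * deriv f z = M * ((z1 - z) * deriv b z)"
        by (simp add: mult_ac)
      also have "\<dots> = - M - of_real k * f z"
        using log_branch_ode[OF b that] \<open>k = 0\<close> by simp
      finally show ?thesis .
    qed
    then show ?thesis by (rule that)
  qed
  have rec: "of_nat (n + 1) * z1 * c (n + 1) = (of_nat n - of_real k) * c n" if "n \<ge> 1" for n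
    unfolding c by (rule taylor_recurrence[OF hol _ _ ode that]) auto
  have "complex_of_real k =
          of_nat n + (of_nat n + 1) / (of_nat n + 1 - (of_nat n + 2) * D c n) \<and>
        z1 = (of_nat n - of_real k) / ((of_nat n + 1) * R c n)"
    if n: "n \<ge> 1" "c n \<noteq> 0" "c (n + 1) \<noteq> 0" for n
    using index_and_location_from_recurrence[of n z1 c "of_real k"] rec[of n] rec[of "n + 1"] n z1
    by simp
  moreover have "c 0 = f 0"
    using c[of 0] by simp
  moreover have "M = f 0 / b 0" if "algebraic_type f z1 k M b"
    using that power_branch_0_nonzero[of z1 k b] z1 by (simp add: algebraic_type_def)
  moreover have "M = f 0 / b 0" if "logarithmic_type f z1 k M b"
    using that log_branch_0_nonzero[of z1 b] by (simp add: logarithmic_type_def)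
  ultimately show ?thesis
    by simp
qed

end
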